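(* Let the interconnected system $\dot y=h(y)$, $y=(x,z)\in\mathbb{R}^n\times\mathbb{R}^m$, $h=(f,g)$, and the functions $V,W,\lambda_x,\lambda_z$ be as in the context. Assume that the region-dependent gain condition holds for $(\underline M,\overline M,\underline N,\overline N,\gamma,\delta)$ with $\underline M=\underline N=0$, $\overline M=M_\ell$ and $\overline N=N_\ell$, where $M_\ell<\infty$ or $N_\ell<\infty$. Then the set $\{y\in\mathbb{R}^{n+m}:U_\ell(y)\le\widehat M_\ell\}$ is included in the basin of attraction of the origin of $\dot y=h(y)$, where $U_\ell$ and $\widehat M_\ell=\min\{\delta(M_\ell),N_\ell\}$ are the function $U$ and the constant $\widehat M$ given by the existence result (P) of the context for these data.
   Context: Notation. $\mathcal{K}_\infty$ is the class of continuous, strictly increasing, unbounded functions $\gamma:\mathbb{R}_{\ge0}\to\mathbb{R}_{\ge0}$ with $\gamma(0)=0$. A continuous function $\varphi:\mathbb{R}^k\to\mathbb{R}$ is positive definite if $\varphi(0)=0$ and $\varphi(x)>0$ for $x\neq0$; it is proper if $|\varphi(x)|\to\infty$ as $|x|\to\infty$. Conventions: $\delta(\infty)=\infty$ for $\delta\in\mathcal{K}_\infty$; constraints "$\le\infty$" are void. System. $f\in C^1(\mathbb{R}^{n+m},\mathbb{R}^n)$, $g\in C^1(\mathbb{R}^{n+m},\mathbb{R}^m)$, $n,m\ge1$. The interconnected system is $\dot x=f(x,z)$, $\dot z=g(x,z)$, written $\dot y=h(y)$ with $y=(x,z)$; $Y(t,y)$ is its solution at time $t$ starting from $y$. The origin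 is input-to-state stable (ISS) for each of the subsystems $\dot x=f(x,u)$ (input $u$) and $\dot z=g(v,z)$ (input $v$). Dini derivatives. $D^+_fV(x,z)=\limsup_{\tau\searrow0}\frac{V(x+\tau f(x,z))-V(x)}{\tau}$ and $D^+_gW(x,z)=\limsup_{\tau\searrow0}\frac{W(z+\tau g(x,z))-W(z)}{\tau}$. Storage functions. $V:\mathbb{R}^n\to\mathbb{R}_{\ge0}$ and $W:\mathbb{R}^m\to\mathbb{R}_{\ge0}$ are locally Lipschitz, each bounded below and above by $\mathcal{K}_\infty$ functions of the norm of its argument. They are ISS-Lyapunov functions for the two subsystems: there are a continuous, positive definite, proper function $\lambda_x:\mathbb{R}^n\to\mathbb{R}_{\ge0}$, a continuous, positive definite function $\lambda_z:\mathbb{R}^m\to\mathbb{R}_{\ge0}$, and $\alpha_x,\alpha_z\in\mathcal{K}_\infty$ such that for all $(x,z)$: $|x|\ge\alpha_x(|z|)\Rightarrow D_f^+V(x,z)\le-\lambda_x(x)$, and $W(z)\ge\alpha_z(|x|)\Rightarrow D_g^+W(x,z)\le-\lambda_z(z)$. Region-dependent gain condition for $(\underline M,\overline M,\underline N,\overline N,\gamma,\delta)$, where $0\le\underline M<\overline M\le\infty$, $0\le\underline N<\overline N\le\infty$, $\gamma,\delta\in\mathcal{K}_\infty$: (i) for every $(x,z)\in\mathbf{S}$, $V(x)\ge\gamma(W(z))\Rightarrow D_f^+V(x,z)\le-\lambda_x(x)$ and $W(z)\ge\delta(V(x))\Rightarrow D_g^+W(x,z)\le-\lambda_z(z)$,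 where $\mathbf{S}=\{(x,z):\underline M\le V(x)\le\overline M,\ W(z)\le\overline N\}\cup\{(x,z):V(x)\le\overline M,\ \underline N\le W(z)\le\overline N\}$; (ii) $\gamma\circ\delta(s)<s$ for all $s\in[\underline M,\overline M]\setminus\{0\}$ if $\overline M<\infty$, and for all $s\in[\underline M,\infty)\setminus\{0\}$ if $\overline M=\infty$. Existence result (P). Suppose the region-dependent gain condition holds for $(\underline M,\overline M,\underline N,\overline N,\gamma,\delta)$ and $\widetilde M:=\max\{\gamma^{-1}(\underline M),\underline N\}<\min\{\delta(\overline M),\overline N\}=:\widehat M$. Then there exists a proper, positive definite function $U:\mathbb{R}^{n+m}\to\mathbb{R}_{\ge0}$, locally Lipschitz on $\mathbb{R}^{n+m}\setminus\{0\}$, such that $\limsup_{t\to\infty}U(Y(t,y))\le\widetilde M$ for every $y$ with $\widetilde M<U(y)\le\widehat M$. Moreover, if $\gamma,\delta$ are also $C^1$, a suitable $U$ is $U(x,z)=\max\{\tfrac12(\delta(V(x))+\gamma^{-1}(V(x))),\,W(z)\}$. (When $\underline M=\underline N=0$ one has $\widetilde M=0<\widehat M$ automatically.) The basin of attraction of the origin is the set of initial conditions whose solution exists for all $t\ge0$ and converges to the origin as $t\to\infty$. *)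

theory Defs
  imports "HOL-Analysis.Analysis"
begin

section \<open>Comparison functions and regularity\<close>

text \<open>Functions on the nonnegative reals are total functions on \<^typ>\<open>real\<close> constrained on \<open>{0..}\<close> only.\<close>

definition class_K :: "(real \<Rightarrow> real) \<Rightarrow> bool" where
  "class_K \<gamma> \<longleftrightarrow> continuous_on {0..} \<gamma> \<and> strict_mono_on {0..} \<gamma> \<and> \<gamma> 0 = 0"

definition class_Kinf :: "(real \<Rightarrow> real) \<Rightarrow> bool" where
  "class_Kinf \<gamma> \<longleftrightarrow> class_K \<gamma> \<and> filterlim \<gamma> at_top at_top"

definition class_KL :: "(real \<Rightarrow> real \<Rightarrow> real) \<Rightarrow> bool" where
  "class_KL \<beta> \<longleftrightarrow>
     continuous_on ({0..} \<times> {0..}) (\<lambda>(r, t). \<beta> r t) \<and>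
     (\<forall>t\<ge>0. class_K (\<lambda>r. \<beta> r t)) \<and>
     (\<forall>r\<ge>0. antimono_on {0..} (\<beta> r) \<and> (\<beta> r \<longlongrightarrow> 0) at_top)"

definition Kinf_inv :: "(real \<Rightarrow> real) \<Rightarrow> real \<Rightarrow> real" where
  "Kinf_inv \<gamma> = inv_into {0..} \<gamma>"

text \<open>The convention that a class-\<open>K\<^sub>\<infinity>\<close> function maps \<open>\<infinity>\<close> to \<open>\<infinity>\<close>.\<close>

definition Kinf_ext :: "(real \<Rightarrow> real) \<Rightarrow> ereal \<Rightarrow> ereal" where
  "Kinf_ext \<delta> M = (if M = \<infinity> then \<infinity> else ereal (\<delta> (real_of_ereal M)))"

definition pos_def :: "('a::real_normed_vector \<Rightarrow> real) \<Rightarrow> bool" where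
  "pos_def \<phi> \<longleftrightarrow> continuous_on UNIV \<phi> \<and> \<phi> 0 = 0 \<and> (\<forall>x. x \<noteq> 0 \<longrightarrow> \<phi> x > 0)"

definition radially_proper :: "('a::real_normed_vector \<Rightarrow> real) \<Rightarrow> bool" where
  "radially_proper \<phi> \<longleftrightarrow> filterlim (\<lambda>x. \<bar>\<phi> x\<bar>) at_top at_infinity"

definition locally_lipschitz_on :: "'a::metric_space set \<Rightarrow> ('a \<Rightarrow> 'b::metric_space) \<Rightarrow> bool" where
  "locally_lipschitz_on S \<phi> \<longleftrightarrow> (\<forall>x\<in>S. \<exists>\<epsilon>>0. \<exists>L. L-lipschitz_on (ball x \<epsilon> \<inter> S) \<phi>)"

definition C1_on :: "'a::real_normed_vector set \<Rightarrow> ('a \<Rightarrow> 'b::real_normed_vector) \<Rightarrow> bool" where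
  "C1_on S \<phi> \<longleftrightarrow>
     (\<exists>\<phi>'. (\<forall>x\<in>S. (\<phi> has_derivative blinfun_apply (\<phi>' x)) (at x within S)) \<and> continuous_on S \<phi>')"

definition Kinf_bounded :: "('a::real_normed_vector \<Rightarrow> real) \<Rightarrow> bool" where
  "Kinf_bounded \<phi> \<longleftrightarrow>
     (\<exists>a b. class_Kinf a \<and> class_Kinf b \<and> (\<forall>x. a (norm x) \<le> \<phi> x \<and> \<phi> x \<le> b (norm x)))"

text \<open>Upper right Dini derivative of \<open>\<phi>\<close> at \<open>p\<close> in direction \<open>v\<close>, so that
  \<open>D\<^sup>+\<^sub>f V (x, z)\<close> is \<open>dini_upper V x (f (x, z))\<close>.\<close>

definition dini_upper :: "('a::real_vector \<Rightarrow> real) \<Rightarrow> 'a \<Rightarrow> 'a \<Rightarrow> ereal" where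
  "dini_upper \<phi> p v = Limsup (at_right 0) (\<lambda>\<tau>. ereal ((\<phi> (p + \<tau> *\<^sub>R v) - \<phi> p) / \<tau>))"

section \<open>Input-to-state stability\<close>

definition admissible_input :: "(real \<Rightarrow> 'i::euclidean_space) \<Rightarrow> bool" where
  "admissible_input u \<longleftrightarrow>
     u \<in> borel_measurable lebesgue \<and>
     (\<forall>t\<ge>0. \<exists>r. AE s in lebesgue. s \<in> {0..t} \<longrightarrow> norm (u s) \<le> r)"

text \<open>The essential supremum norm of the restriction of \<open>u\<close> to \<open>{0..t}\<close>.\<close>

definition input_norm :: "(real \<Rightarrow> 'i::euclidean_space) \<Rightarrow> real \<Rightarrow> real" where
  "input_norm u t = Inf {r. r \<ge> 0 \<and> (AE s in lebesgue. s \<in> {0..t} \<longrightarrow> norm (u s) \<le> r)}"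

text \<open>Caratheodory solutions on \<open>{0..}\<close>, in integral form, since inputs are only measurable.\<close>

definition controlled_solution ::
  "('s \<Rightarrow> 'i \<Rightarrow> 's) \<Rightarrow> (real \<Rightarrow> 'i) \<Rightarrow> 's::euclidean_space \<Rightarrow> (real \<Rightarrow> 's) \<Rightarrow> bool" where
  "controlled_solution F u x0 x \<longleftrightarrow>
     continuous_on {0..} x \<and>
     (\<forall>t\<ge>0. ((\<lambda>s. F (x s) (u s)) has_integral (x t - x0)) {0..t})"

text \<open>For \<open>F\<close> of class \<open>C\<^sup>1\<close> the solution is unique, so the inner existential speaks about
  the solution.\<close>

definition ISS :: "('s::euclidean_space \<Rightarrow> 'i::euclidean_space \<Rightarrow> 's) \<Rightarrow> bool" where
  "ISS F \<longleftrightarrow>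
     (\<exists>\<beta> \<rho>. class_KL \<beta> \<and> class_K \<rho> \<and>
        (\<forall>x0 u. admissible_input u \<longrightarrow>
           (\<exists>x. controlled_solution F u x0 x \<and>
              (\<forall>t\<ge>0. norm (x t) \<le> \<beta> (norm x0) t + \<rho> (input_norm u t)))))"

section \<open>Interconnected system and basin of attraction\<close>

definition interconnection :: "('a \<times> 'b \<Rightarrow> 'a) \<Rightarrow> ('a \<times> 'b \<Rightarrow> 'b) \<Rightarrow> 'a \<times> 'b \<Rightarrow> 'a \<times> 'b" where
  "interconnection f g y = (f y, g y)"

definition global_solution :: "('s \<Rightarrow> 's) \<Rightarrow> 's::real_normed_vector \<Rightarrow> (real \<Rightarrow> 's) \<Rightarrow> bool" where
  "global_solution h y0 Y \<longleftrightarrow>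
     Y 0 = y0 \<and> (\<forall>t\<ge>0. (Y has_vector_derivative h (Y t)) (at t within {0..}))"

definition basin_of_attraction :: "('s::real_normed_vector \<Rightarrow> 's) \<Rightarrow> 's set" where
  "basin_of_attraction h = {y. \<exists>Y. global_solution h y Y \<and> (Y \<longlongrightarrow> 0) at_top}"

section \<open>Region-dependent gain condition\<close>

definition gain_region ::
  "('a \<Rightarrow> real) \<Rightarrow> ('b \<Rightarrow> real) \<Rightarrow> real \<Rightarrow> ereal \<Rightarrow> real \<Rightarrow> ereal \<Rightarrow> ('a \<times> 'b) set" where
  "gain_region V W Ml Mu Nl Nu =
     {(x, z). Ml \<le> V x \<and> ereal (V x) \<le> Mu \<and> ereal (W z) \<le> Nu} \<union>
     {(x, z). ereal (V x) \<le> Mu \<and> Nl \<le> W z \<and> ereal (W z) \<le> Nu}"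

definition region_gain_condition ::
  "('a::real_vector \<times> 'b::real_vector \<Rightarrow> 'a) \<Rightarrow> ('a \<times> 'b \<Rightarrow> 'b) \<Rightarrow>
   ('a \<Rightarrow> real) \<Rightarrow> ('b \<Rightarrow> real) \<Rightarrow> ('a \<Rightarrow> real) \<Rightarrow> ('b \<Rightarrow> real) \<Rightarrow>
   real \<Rightarrow> ereal \<Rightarrow> real \<Rightarrow> ereal \<Rightarrow> (real \<Rightarrow> real) \<Rightarrow> (real \<Rightarrow> real) \<Rightarrow> bool" where
  "region_gain_condition f g V W lx lz Ml Mu Nl Nu \<gamma> \<delta> \<longleftrightarrow>
     0 \<le> Ml \<and> ereal Ml < Mu \<and> 0 \<le> Nl \<and> ereal Nl < Nu \<and> class_Kinf \<gamma> \<and> class_Kinf \<delta> \<and>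
     (\<forall>(x, z) \<in> gain_region V W Ml Mu Nl Nu.
        (V x \<ge> \<gamma> (W z) \<longrightarrow> dini_upper V x (f (x, z)) \<le> ereal (- lx x)) \<and>
        (W z \<ge> \<delta> (V x) \<longrightarrow> dini_upper W z (g (x, z)) \<le> ereal (- lz z))) \<and>
     (\<forall>s. Ml \<le> s \<and> ereal s \<le> Mu \<and> s \<noteq> 0 \<longrightarrow> \<gamma> (\<delta> s) < s)"

definition M_tilde :: "real \<Rightarrow> real \<Rightarrow> (real \<Rightarrow> real) \<Rightarrow> real" where
  "M_tilde Ml Nl \<gamma> = max (Kinf_inv \<gamma> Ml) Nl"

definition M_hat :: "ereal \<Rightarrow> ereal \<Rightarrow> (real \<Rightarrow> real) \<Rightarrow> ereal" where
  "M_hat Mu Nu \<delta> = min (Kinf_ext \<delta> Mu) Nu"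

text \<open>The properties of the function \<open>U\<close> provided by the existence result for \<open>h\<close> and the
  levels \<open>m < M\<close>. An upper limit of \<open>U (Y (t, y))\<close> as \<open>t\<close> tends to infinity presupposes that the solution
  starting from \<open>y\<close> exists for all \<open>t \<ge> 0\<close>, hence the existential quantifier (for \<open>h\<close> of class
  \<open>C\<^sup>1\<close> the solution is unique).\<close>

definition decay_function ::
  "('s::real_normed_vector \<Rightarrow> 's) \<Rightarrow> real \<Rightarrow> ereal \<Rightarrow> ('s \<Rightarrow> real) \<Rightarrow> bool" where
  "decay_function h m M U \<longleftrightarrow>
     radially_proper U \<and> pos_def U \<and> locally_lipschitz_on (- {0}) U \<and>
     (\<forall>y. m < U y \<and> ereal (U y) \<le> M \<longrightarrow>
        (\<exists>Y. global_solution h y Y \<and> Limsup at_top (\<lambda>t. ereal (U (Y t))) \<le> ereal m))"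

definition explicit_U ::
  "('a \<Rightarrow> real) \<Rightarrow> ('b \<Rightarrow> real) \<Rightarrow> (real \<Rightarrow> real) \<Rightarrow> (real \<Rightarrow> real) \<Rightarrow> 'a \<times> 'b \<Rightarrow> real" where
  "explicit_U V W \<gamma> \<delta> = (\<lambda>(x, z). max ((\<delta> (V x) + Kinf_inv \<gamma> (V x)) / 2) (W z))"

end

theory Submission
  imports Defs
begin

text \<open>The sublevel set of \<open>explicit_U\<close> at the level \<open>b = M_hat\<close> is covered by boxes
  \<open>{V \<le> a, W \<le> b}\<close> with \<open>\<delta> a \<le> b\<close> and \<open>\<gamma> b \<le> a\<close>. On the faces of such a box the Dini
  derivatives of \<open>V\<close> and \<open>W\<close> along the flow are strictly negative, so the box is forward invariant
  and, being bounded, carries global solutions. Inside it, \<open>W \<le> r\<close> eventually implies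
  \<open>V \<le> \<gamma> r\<close> eventually, and \<open>V \<le> r\<close> eventually implies \<open>W \<le> \<delta> r\<close> eventually; iterating
  \<open>\<gamma> \<circ> \<delta> < id\<close> drives both to zero. The comparison is made with \<open>V\<close> and \<open>W\<close> separately, so
  no derivative of \<open>\<gamma>\<close> or \<open>\<delta>\<close> enters. For the existence of a decay function, a steep
  multiple of the norm suffices: its sublevel set lies in the box with \<open>a = \<gamma> b\<close>.\<close>

section \<open>Global solutions\<close>

text \<open>A bounded field gives at most linear growth, so dividing by an exponential puts
  solutions among the bounded continuous functions. Banach's fixed point theorem there yields the
  whole half-line at once, without gluing local solutions.\<close>

lemma global_solution_exists:
  fixes h :: "'a::euclidean_space \<Rightarrow> 'a"
  assumes lip: "L-lipschitz_on UNIV h" and bdd: "bounded (range h)"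
  obtains Y where "global_solution h y0 Y"
proof -
  obtain B where B: "norm (h y) \<le> B" for y
    using bdd unfolding bounded_iff by auto
  have L0: "L \<ge> 0" using lip lipschitz_on_nonneg by blast
  have B0: "B \<ge> 0" using norm_ge_zero B order_trans by blast
  \<comment> \<open>Any positive \<open>c > L\<close> would do; the summand 1 covers
    \<open>L = 0\<close>.\<close>
  define c where "c = 2 * L + 1"
  have c0: "c > 0" and Lc: "0 \<le> L / c" "L / c < 1" using L0 by (auto simp: c_def field_simps)
  have hcont: "continuous_on S h" for S
    using lip lipschitz_on_continuous_on lipschitz_on_subset by blast
  text \<open>The Picard operator is conjugated by the weight \<open>exp (c t)\<close>, which makes it a contraction of
    the bounded continuous functions on the whole half-line.\<close>
  define E where "E w t = y0 + integral {0..t} (\<lambda>s. h (exp (c * s) *\<^sub>R w s))"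
    for w :: "real \<Rightarrow> 'a" and t
  have icont: "continuous_on S (\<lambda>s. h (exp (c * s) *\<^sub>R w s))" if "continuous_on UNIV w" for w S
    by (rule continuous_on_compose2[OF hcont[of UNIV]])
      (auto intro!: continuous_intros continuous_on_subset[OF that])
  have deriv: "(E w has_vector_derivative h (exp (c * t) *\<^sub>R w t)) (at t within {0..})"
    if w: "continuous_on UNIV w" and t: "t \<ge> 0" for w t
  proof -
    \<comment> \<open>The interval reaches beyond \<open>t\<close>, so its within-filter at
      \<open>t\<close> is that of the half-line.\<close>
    have "(E w has_vector_derivative h (exp (c * t) *\<^sub>R w t)) (at t within {0..t+1})"
      unfolding E_def has_vector_derivative_add_const add.commute[of y0]
      by (rule integral_has_vector_derivative[OF icont[OF w]]) (use t in auto)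
    moreover have "at t within {0..t+1} = at t within {0..}"
      by (rule at_within_nhd[of t "{..<t+1}"]) auto
    ultimately show ?thesis by simp
  qed
  have Econt: "continuous_on {0..} (E w)" if "continuous_on UNIV w" for w
    using deriv[OF that] by (intro continuous_on_vector_derivative) auto
  \<comment> \<open>Bounded continuous functions live on all of the reals; \<open>max 0 t\<close>
    extends by the value at time 0.\<close>
  define T where "T w t = exp (- c * max 0 t) *\<^sub>R E w (max 0 t)" for w t
  have Tcont: "continuous_on UNIV (T w)" if "continuous_on UNIV w" for w
    unfolding T_def
    by (intro continuous_intros continuous_on_compose2[OF Econt[OF that]]) auto
  have Tbound: "norm (T w t) \<le> norm y0 + B / c" if w: "continuous_on UNIV w" for w t
  proof -
    define s where "s = max 0 t"
    have s: "s \<ge> 0" by (simp add: s_def)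
    have "norm (integral {0..s} (\<lambda>s. h (exp (c * s) *\<^sub>R w s))) \<le> B * (s - 0)"
      by (rule integral_bound) (use s icont[OF w] B in auto)
    then have "norm (E w s) \<le> norm y0 + B * s"
      unfolding E_def by (intro norm_triangle_le) simp
    then have "norm (T w t) \<le> exp (- c * s) * (norm y0 + B * s)"
      by (simp add: T_def s_def[symmetric])
    also have "\<dots> = exp (- c * s) * norm y0 + B / c * (c * s * exp (- c * s))"
      using c0 by (simp add: field_simps)
    also have "\<dots> \<le> 1 * norm y0 + B / c * 1"
    proof (intro add_mono mult_mono mult_left_mono)
      have "c * s \<le> exp (c * s)" using exp_ge_add_one_self[of "c * s"] by linarith
      then show "c * s * exp (- c * s) \<le> 1" by (simp add: exp_minus field_simps)
    qed (use s c0 B0 in auto)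
    finally show ?thesis by simp
  qed
  define \<T> where "\<T> w = Bcontfun (T (apply_bcontfun w))" for w
  have \<T>: "apply_bcontfun (\<T> w) = T (apply_bcontfun w)" for w
    unfolding \<T>_def
    by (intro Bcontfun_inverse bcontfun_normI[of _ "norm y0 + B / c"] Tcont Tbound) auto
  have contr: "dist (\<T> u) (\<T> w) \<le> L / c * dist u w" for u w
  proof (rule dist_bound, unfold \<T>)
    fix t :: real
    define s where "s = max 0 t"
    have s: "s \<ge> 0" by (simp add: s_def)
    define d where "d = dist u w"
    let ?hu = "\<lambda>r. h (exp (c * r) *\<^sub>R u r)" and ?hw = "\<lambda>r. h (exp (c * r) *\<^sub>R w r)"
    have int: "?hu integrable_on {0..s}" "?hw integrable_on {0..s}"
      by (intro integrable_continuous_real icont; simp)+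
    \<comment> \<open>Integrating the weight produces the factor \<open>1 / c\<close> that beats
      \<open>L\<close>. The boundary term at 0 is negative or zero and is dropped below.\<close>
    have I: "((\<lambda>r. L * d * exp (c * r)) has_integral
               (L * d / c * exp (c * s) - L * d / c * exp (c * 0))) {0..s}"
      using s c0 by (intro fundamental_theorem_of_calculus)
        (auto simp flip: has_real_derivative_iff_has_vector_derivative
              intro!: derivative_eq_intros)
    have "norm (E u s - E w s) = norm (integral {0..s} (\<lambda>r. ?hu r - ?hw r))"
      unfolding E_def using int by (simp add: integral_diff)
    also have "\<dots> \<le> integral {0..s} (\<lambda>r. L * d * exp (c * r))"
    proof (rule integral_norm_bound_integral)
      fix r assume "r \<in> {0..s}"
      have "norm (?hu r - ?hw r) \<le> L * dist (exp (c * r) *\<^sub>R u r) (exp (c * r) *\<^sub>R w r)"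
        using lipschitz_onD[OF lip] by (simp add: dist_norm)
      also have "\<dots> = L * (exp (c * r) * dist (u r) (w r))"
        by (simp add: dist_norm flip: scaleR_diff_right)
      also have "\<dots> \<le> L * (exp (c * r) * d)"
        unfolding d_def using L0 by (intro mult_left_mono dist_bounded) auto
      finally show "norm (?hu r - ?hw r) \<le> L * d * exp (c * r)" by (simp add: mult_ac)
    qed (use int I in \<open>auto intro!: integrable_diff simp: has_integral_iff\<close>)
    also have "\<dots> \<le> L / c * d * exp (c * s)"
      using integral_unique[OF I] L0 c0 by (simp add: d_def)
    finally have "norm (E u s - E w s) \<le> L / c * d * exp (c * s)" .
    then have "exp (- c * s) * norm (E u s - E w s)
        \<le> exp (- c * s) * (L / c * d * exp (c * s))"
      by (intro mult_left_mono) auto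
    moreover have "dist (T u t) (T w t) = exp (- c * s) * norm (E u s - E w s)"
      unfolding T_def dist_norm s_def[symmetric] by (simp flip: scaleR_diff_right)
    moreover have "exp (- c * s) * (L / c * d * exp (c * s)) = L / c * d"
      by (simp add: exp_minus)
    ultimately show "dist (T u t) (T w t) \<le> L / c * dist u w"
      unfolding d_def by linarith
  qed
  obtain w where w: "\<T> w = w"
    using banach_fix_type[OF Lc, of \<T>] contr by blast
  have fix_eq: "exp (c * t) *\<^sub>R w t = E w t" if "t \<ge> 0" for t
  proof -
    have "w t = T (apply_bcontfun w) t" by (metis \<T> w)
    also have "\<dots> = exp (- c * t) *\<^sub>R E w t" using that by (simp add: T_def)
    finally have "w t = exp (- c * t) *\<^sub>R E w t" .
    then show ?thesis by (simp add: exp_minus)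
  qed
  have "global_solution h y0 (E w)"
    unfolding global_solution_def
    using deriv[of "apply_bcontfun w"] fix_eq by (auto simp: E_def)
  then show ?thesis by (rule that)
qed

text \<open>The derivative is bounded on the compact ball, and the mean value inequality on this
  convex set turns the bound into a Lipschitz constant.\<close>

lemma C1_lipschitz_on_cball:
  fixes \<phi> :: "'a::euclidean_space \<Rightarrow> 'b::real_normed_vector"
  assumes "C1_on UNIV \<phi>"
  obtains L where "L-lipschitz_on (cball 0 R) \<phi>"
proof -
  obtain \<phi>' where d: "\<And>x. (\<phi> has_derivative blinfun_apply (\<phi>' x)) (at x)"
    and c: "continuous_on UNIV \<phi>'"
    using assms by (auto simp: C1_on_def)
  have "bounded (\<phi>' ` cball 0 R)"
    by (intro compact_imp_bounded compact_continuous_image continuous_on_subset[OF c]) auto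
  then obtain B where B: "B > 0" "\<And>x. x \<in> cball 0 R \<Longrightarrow> norm (\<phi>' x) \<le> B"
    unfolding bounded_pos by blast
  have "B-lipschitz_on (cball 0 R) \<phi>"
  proof (rule lipschitz_onI)
    fix x y :: 'a assume "x \<in> cball 0 R" "y \<in> cball 0 R"
    then show "dist (\<phi> x) (\<phi> y) \<le> B * dist x y"
      unfolding dist_norm
      by (intro differentiable_bound[of "cball 0 R" \<phi> "\<lambda>x. blinfun_apply (\<phi>' x)"])
        (auto intro: has_derivative_at_withinI[OF d] B(2) simp flip: norm_blinfun.rep_eq)
  qed (use B in simp)
  then show ?thesis by (rule that)
qed

text \<open>Projecting onto the ball makes the field bounded and globally Lipschitz and leaves it
  unchanged inside. A solution that never leaves the ball therefore solves the original
  equation.\<close>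

lemma truncated_solution_exists:
  fixes h :: "'a::euclidean_space \<Rightarrow> 'a"
  assumes lip: "L-lipschitz_on (cball 0 R) h" and R: "R \<ge> 0"
  obtains Y where "global_solution (\<lambda>y. h (closest_point (cball 0 R) y)) y0 Y"
proof -
  let ?P = "closest_point (cball (0::'a) R)"
  have P: "?P y \<in> cball 0 R" for y
    using R by (intro closest_point_in_set) auto
  have P1: "1-lipschitz_on UNIV ?P"
    using R by (intro lipschitz_onI) (auto intro!: closest_point_lipschitz)
  have "(L * 1)-lipschitz_on UNIV (\<lambda>y. h (?P y))"
    by (rule lipschitz_on_compose2[OF P1 lipschitz_on_subset[OF lip]]) (use P in blast)
  moreover have "bounded (range (\<lambda>y. h (?P y)))"
  proof (rule bounded_subset)
    show "bounded (h ` cball 0 R)"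
      by (intro compact_imp_bounded compact_continuous_image lipschitz_on_continuous_on[OF lip])
        auto
  qed (use P in blast)
  ultimately show ?thesis using global_solution_exists that by blast
qed

section \<open>Decrease along solutions\<close>

text \<open>Continuous induction: closedness puts the last time up to \<open>t\<close> at which
  \<open>P\<close> holds into the set, and if this time were smaller than \<open>t\<close>,
  \<open>step\<close> would produce a later one.\<close>

lemma forward_induction:
  fixes P :: "real \<Rightarrow> bool"
  assumes closed: "closed {t \<in> {T..}. P t}" and start: "P T"
    and step: "\<And>t. T \<le> t \<Longrightarrow> P t \<Longrightarrow> \<forall>\<^sub>F \<tau> in at_right 0. P (t + \<tau>)"
    and t: "T \<le> t"
  shows "P t"
proof (rule ccontr)
  assume "\<not> P t"
  define S where "S = {r \<in> {T..}. P r} \<inter> {..t}"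
  have bdd: "bdd_above S" and "closed S"
    using closed by (auto simp: S_def intro: bdd_above_mono[of "{..t}"])
  moreover have "T \<in> S" using t start by (simp add: S_def)
  ultimately have "Sup S \<in> S" using closed_contains_Sup by blast
  then have s: "T \<le> Sup S" "P (Sup S)" "Sup S < t"
    using \<open>\<not> P t\<close> by (auto simp: S_def order_less_le)
  from step[OF s(1,2)] obtain e where e: "e > 0" "\<And>\<tau>. 0 < \<tau> \<Longrightarrow> \<tau> < e \<Longrightarrow> P (Sup S + \<tau>)"
    unfolding eventually_at_right_field by auto
  define \<tau> where "\<tau> = min (e / 2) (t - Sup S)"
  have "0 < \<tau>" "\<tau> < e" "Sup S + \<tau> \<le> t" using e(1) s by (auto simp: \<tau>_def)
  then have "Sup S + \<tau> \<in> S" using e(2) s(1) by (auto simp: S_def)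
  then show False using cSup_upper[OF _ bdd] \<open>0 < \<tau>\<close> by fastforce
qed

lemma eventually_right_less:
  fixes u :: "real \<Rightarrow> real"
  assumes "continuous_on {0..} u" "0 \<le> t" "u t < a"
  shows "\<forall>\<^sub>F \<tau> in at_right 0. u (t + \<tau>) < a"
proof -
  have "(u \<longlongrightarrow> u t) (at t within {0..})"
    using assms by (auto simp: continuous_on_def)
  then have "(u \<longlongrightarrow> u t) (at_right t)"
    by (rule tendsto_within_subset) (use assms in auto)
  then have "\<forall>\<^sub>F s in at_right t. u s < a" using assms(3) by (rule order_tendstoD)
  then show ?thesis by (simp add: eventually_at_right_to_0[of _ t] add.commute)
qed

text \<open>While \<open>u\<close> is at least \<open>a\<close> it falls at rate at least
  \<open>k\<close>, so it stays below a line of slope \<open>- k\<close> cut off at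
  \<open>a\<close>, which reaches \<open>a\<close> in finite time. Only right-sided local estimates
  are given, so the comparison runs by \<open>forward_induction\<close>.\<close>

lemma eventually_le_of_decrease:
  fixes u :: "real \<Rightarrow> real"
  assumes cont: "continuous_on {0..} u" and k: "0 < k"
    and dec: "\<forall>\<^sub>F t in at_top. a \<le> u t \<longrightarrow> (\<forall>\<^sub>F \<tau> in at_right 0. u (t + \<tau>) \<le> u t - k * \<tau>)"
  shows "\<forall>\<^sub>F t in at_top. u t \<le> a"
proof -
  obtain T where T: "T \<ge> 0" "\<And>t. T \<le> t \<Longrightarrow> a \<le> u t \<Longrightarrow>
      \<forall>\<^sub>F \<tau> in at_right 0. u (t + \<tau>) \<le> u t - k * \<tau>"
    using dec unfolding eventually_at_top_linorder by (metis max.bounded_iff max.cobounded2)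
  let ?\<phi> = "\<lambda>t. max a (u T - k * (t - T))"
  have le: "u t \<le> ?\<phi> t" if "T \<le> t" for t
  proof (rule forward_induction[OF _ _ _ that])
    show "closed {t \<in> {T..}. u t \<le> ?\<phi> t}"
      by (intro continuous_on_closed_Collect_le continuous_intros continuous_on_subset[OF cont])
        (use T in auto)
  next
    fix t assume t: "T \<le> t" "u t \<le> ?\<phi> t"
    show "\<forall>\<^sub>F \<tau> in at_right 0. u (t + \<tau>) \<le> ?\<phi> (t + \<tau>)"
    proof (cases "u t < a")
      case True
      then have "\<forall>\<^sub>F \<tau> in at_right 0. u (t + \<tau>) < a"
        using cont t T by (intro eventually_right_less) auto
      then show ?thesis by eventually_elim auto
    next
      case False
      then have "\<forall>\<^sub>F \<tau> in at_right 0. u (t + \<tau>) \<le> u t - k * \<tau>" using t T by auto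
      moreover have "\<forall>\<^sub>F \<tau> in at_right 0. \<tau> > (0::real)"
        by (simp add: eventually_at_right_less)
      ultimately show ?thesis
      proof eventually_elim
        case (elim \<tau>)
        then have "k * \<tau> > 0" using k by simp
        then show ?case using elim t by (auto simp: algebra_simps max_def split: if_splits)
      qed
    qed
  qed auto
  \<comment> \<open>The second time is where the line crosses \<open>a\<close>; it precedes
    \<open>T\<close> if \<open>u T < a\<close>, hence both bounds.\<close>
  show ?thesis
    using eventually_ge_at_top[of T] eventually_ge_at_top[of "T + (u T - a) / k"]
  proof eventually_elim
    case (elim t)
    then have "u T - k * (t - T) \<le> a" using k by (simp add: field_simps)
    then show ?case using le elim by fastforce
  qed
qed

text \<open>Local Lipschitz continuity lets the trajectory be replaced by its tangent in the
  Dini difference quotient.\<close>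

lemma dini_upper_decrease:
  fixes V :: "'a::real_normed_vector \<Rightarrow> real"
  assumes lip: "locally_lipschitz_on UNIV V"
    and der: "(X has_vector_derivative p) (at t within {0..})" and t: "0 \<le> t"
    and dini: "dini_upper V (X t) p \<le> ereal (- l)" and k: "k < l"
  shows "\<forall>\<^sub>F \<tau> in at_right 0. V (X (t + \<tau>)) \<le> V (X t) - k * \<tau>"
proof -
  \<comment> \<open>The slack \<open>l - k\<close> is halved: one half for the upper limit, one for
    replacing the trajectory by its tangent.\<close>
  define \<eta> where "\<eta> = (l - k) / 2"
  have \<eta>: "\<eta> > 0" using k by (simp add: \<eta>_def)
  obtain \<epsilon> L where \<epsilon>: "\<epsilon> > 0" and L: "L-lipschitz_on (ball (X t) \<epsilon>) V"
    using lip unfolding locally_lipschitz_on_def Int_UNIV_right by blast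
  have L0: "L \<ge> 0" using L lipschitz_on_nonneg by blast
  define e where "e = \<eta> / (L + 1)"
  have e: "e > 0" "L * e \<le> \<eta>" using \<eta> L0 by (auto simp: e_def field_simps)
  have "dini_upper V (X t) p < ereal (- l + \<eta>)"
    using dini \<eta> by (auto elim: order.strict_trans1)
  then have "\<forall>\<^sub>F \<tau> in at_right 0. (V (X t + \<tau> *\<^sub>R p) - V (X t)) / \<tau> < - l + \<eta>"
    unfolding dini_upper_def by (drule_tac Limsup_lessD) simp
  moreover obtain d where d: "d > 0" "\<And>s. s \<ge> 0 \<Longrightarrow> norm (s - t) < d \<Longrightarrow>
      norm (X s - X t - (s - t) *\<^sub>R p) \<le> e * norm (s - t)"
    using der e unfolding has_vector_derivative_def has_derivative_within_alt by force
  have "\<forall>\<^sub>F \<tau> in at_right 0. \<tau> \<in> {0<..<d}"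
    using d by (intro eventually_at_right_real)
  \<comment> \<open>This bound keeps both the trajectory and its tangent in the ball where
    \<open>V\<close> is Lipschitz.\<close>
  moreover have "\<forall>\<^sub>F \<tau> in at_right 0. \<tau> \<in> {0<..<\<epsilon> / (norm p + e)}"
    using \<epsilon> e by (intro eventually_at_right_real) (auto intro!: divide_pos_pos add_nonneg_pos)
  ultimately show ?thesis
  proof eventually_elim
    case (elim \<tau>)
    then have \<tau>: "\<tau> > 0" by simp
    have n: "norm (X (t + \<tau>) - X t - \<tau> *\<^sub>R p) \<le> e * \<tau>"
      using d(2)[of "t + \<tau>"] elim t by simp
    have small: "\<tau> * (norm p + e) < \<epsilon>"
      using elim e add_nonneg_pos[OF norm_ge_zero[of p] e(1)] by (simp add: field_simps)
    have "norm (X (t + \<tau>) - X t) \<le> norm (X (t + \<tau>) - X t - \<tau> *\<^sub>R p) + norm (\<tau> *\<^sub>R p)"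
      using norm_triangle_ineq[of "X (t + \<tau>) - X t - \<tau> *\<^sub>R p" "\<tau> *\<^sub>R p"] by simp
    then have "X (t + \<tau>) \<in> ball (X t) \<epsilon>"
      using n small \<tau> by (simp add: dist_norm norm_minus_commute algebra_simps)
    moreover have "\<tau> * norm p \<le> \<tau> * (norm p + e)" using \<tau> e by simp
    then have "X t + \<tau> *\<^sub>R p \<in> ball (X t) \<epsilon>"
      using order.strict_trans1[OF _ small] \<tau> by (simp add: dist_norm)
    ultimately have "dist (V (X (t + \<tau>))) (V (X t + \<tau> *\<^sub>R p))
        \<le> L * dist (X (t + \<tau>)) (X t + \<tau> *\<^sub>R p)"
      by (rule lipschitz_onD[OF L])
    also have "\<dots> \<le> L * (e * \<tau>)"
      using n L0 by (intro mult_left_mono) (auto simp: dist_norm diff_diff_eq)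
    also have "\<dots> \<le> \<eta> * \<tau>" using e \<tau> mult_right_mono[of "L * e" \<eta> \<tau>] by simp
    finally have "V (X (t + \<tau>)) \<le> V (X t + \<tau> *\<^sub>R p) + \<eta> * \<tau>" by (simp add: dist_real_def)
    moreover have "V (X t + \<tau> *\<^sub>R p) - V (X t) < (- l + \<eta>) * \<tau>"
      using elim \<tau> by (simp add: divide_less_eq)
    ultimately have "V (X (t + \<tau>)) \<le> V (X t) + (- l + \<eta> + \<eta>) * \<tau>"
      by (simp add: algebra_simps)
    also have "- l + \<eta> + \<eta> = - k" by (simp add: \<eta>_def field_simps)
    finally show ?case by simp
  qed
qed

lemma locally_lipschitz_on_imp_continuous_on:
  assumes "locally_lipschitz_on S \<phi>"
  shows "continuous_on S \<phi>"
  unfolding continuous_on_eq_continuous_within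
proof
  fix x assume x: "x \<in> S"
  then obtain \<epsilon> L where \<epsilon>: "\<epsilon> > 0" and L: "L-lipschitz_on (ball x \<epsilon> \<inter> S) \<phi>"
    using assms unfolding locally_lipschitz_on_def by blast
  have "continuous (at x within ball x \<epsilon> \<inter> S) \<phi>"
    using lipschitz_on_continuous_on[OF L] x \<epsilon> by (simp add: continuous_on_eq_continuous_within)
  moreover have "at x within ball x \<epsilon> \<inter> S = at x within S"
    using \<epsilon> by (intro at_within_nhd[of x "ball x \<epsilon>"]) auto
  ultimately show "continuous (at x within S) \<phi>" by simp
qed

section \<open>Comparison functions\<close>

lemma class_Kinf_zero: "class_Kinf \<gamma> \<Longrightarrow> \<gamma> 0 = 0"
  by (simp add: class_Kinf_def class_K_def)

lemma class_Kinf_less: "class_Kinf \<gamma> \<Longrightarrow> 0 \<le> s \<Longrightarrow> s < t \<Longrightarrow> \<gamma> s < \<gamma> t"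
  by (auto simp: class_Kinf_def class_K_def strict_mono_on_def)

lemma class_Kinf_le: "class_Kinf \<gamma> \<Longrightarrow> 0 \<le> s \<Longrightarrow> s \<le> t \<Longrightarrow> \<gamma> s \<le> \<gamma> t"
  using class_Kinf_less[of \<gamma> s t] by (cases "s = t") auto

lemma class_Kinf_pos: "class_Kinf \<gamma> \<Longrightarrow> 0 < s \<Longrightarrow> 0 < \<gamma> s"
  using class_Kinf_less[of \<gamma> 0 s] by (simp add: class_Kinf_zero)

lemma class_Kinf_nonneg: "class_Kinf \<gamma> \<Longrightarrow> 0 \<le> s \<Longrightarrow> 0 \<le> \<gamma> s"
  using class_Kinf_le[of \<gamma> 0 s] by (simp add: class_Kinf_zero)

lemma class_Kinf_isCont: "class_Kinf \<gamma> \<Longrightarrow> 0 < s \<Longrightarrow> isCont \<gamma> s"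
  by (rule continuous_on_interior[of "{0..}"]) (auto simp: class_Kinf_def class_K_def)

text \<open>Unboundedness and the intermediate value theorem put \<open>r\<close> in the image of
  the half-line, as \<open>inv_into\<close> requires.\<close>

lemma class_Kinf_Kinf_inv:
  assumes \<gamma>: "class_Kinf \<gamma>" and r: "0 \<le> r"
  shows "0 \<le> Kinf_inv \<gamma> r" "\<gamma> (Kinf_inv \<gamma> r) = r"
proof -
  have "\<forall>\<^sub>F s in at_top. r \<le> \<gamma> s"
    using \<gamma> by (auto simp: class_Kinf_def filterlim_at_top)
  then obtain s where s: "0 \<le> s" "r \<le> \<gamma> s"
    unfolding eventually_at_top_linorder by (metis max.cobounded1 max.cobounded2)
  have "continuous_on {0..s} \<gamma>"
    using \<gamma> by (auto simp: class_Kinf_def class_K_def intro: continuous_on_subset)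
  then have "\<exists>x\<ge>0. x \<le> s \<and> \<gamma> x = r"
    using s r class_Kinf_zero[OF \<gamma>] by (intro IVT') auto
  then have "r \<in> \<gamma> ` {0..}" by auto
  then show "0 \<le> Kinf_inv \<gamma> r" "\<gamma> (Kinf_inv \<gamma> r) = r"
    unfolding Kinf_inv_def using inv_into_into[of r \<gamma> "{0..}"] by (auto simp: f_inv_into_f)
qed

lemma Kinf_inv_zero:
  assumes \<gamma>: "class_Kinf \<gamma>"
  shows "Kinf_inv \<gamma> 0 = 0"
  using class_Kinf_Kinf_inv[OF \<gamma> order_refl] class_Kinf_pos[OF \<gamma>, of "Kinf_inv \<gamma> 0"]
  by linarith

lemma Kinf_bounded_zero: "Kinf_bounded V \<Longrightarrow> V 0 = 0"
  by (metis Kinf_bounded_def class_Kinf_zero norm_zero order_antisym)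

lemma Kinf_bounded_nonneg: "Kinf_bounded V \<Longrightarrow> 0 \<le> V x"
  unfolding Kinf_bounded_def by (meson class_Kinf_nonneg norm_ge_zero order_trans)

lemma Kinf_bounded_sublevel:
  assumes "Kinf_bounded V"
  obtains R where "R \<ge> 0" "\<And>x. V x \<le> c \<Longrightarrow> norm x \<le> R"
proof -
  obtain a where a: "class_Kinf a" "\<And>x. a (norm x) \<le> V x"
    using assms by (auto simp: Kinf_bounded_def)
  have "\<forall>\<^sub>F s in at_top. c < a s"
    using a(1) by (auto simp: class_Kinf_def filterlim_at_top_dense)
  then obtain R where R: "\<And>s. R \<le> s \<Longrightarrow> c < a s"
    unfolding eventually_at_top_linorder by blast
  have "norm x \<le> max R 0" if "V x \<le> c" for x
    using R[of "norm x"] a(2)[of x] that by linarith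
  then show ?thesis by (intro that[of "max R 0"]) auto
qed

lemma Kinf_bounded_tendsto_zero:
  assumes V: "Kinf_bounded V" and lim: "((\<lambda>t. V (X t)) \<longlongrightarrow> 0) F"
  shows "(X \<longlongrightarrow> 0) F"
proof (rule tendstoI)
  fix e :: real assume e: "e > 0"
  obtain a where a: "class_Kinf a" "\<And>x. a (norm x) \<le> V x"
    using V by (auto simp: Kinf_bounded_def)
  have "\<forall>\<^sub>F t in F. V (X t) < a e"
    using lim class_Kinf_pos[OF a(1) e] by (rule order_tendstoD)
  then show "\<forall>\<^sub>F t in F. dist (X t) 0 < e"
  proof eventually_elim
    case (elim t)
    then have "a (norm (X t)) < a e" using a(2)[of "X t"] by linarith
    then show ?case using class_Kinf_le[OF a(1), of e "norm (X t)"] e by fastforce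
  qed
qed

text \<open>A compact set away from the origin has a positive minimum of \<open>l\<close>. This
  makes the decrease rates uniform in time.\<close>

lemma pos_def_lower_bound:
  fixes l :: "'a::euclidean_space \<Rightarrow> real"
  assumes l: "pos_def l" and S: "closed S" "0 \<notin> S"
  obtains k where "k > 0" "\<And>x. x \<in> S \<Longrightarrow> norm x \<le> R \<Longrightarrow> k < l x"
proof (cases "S \<inter> cball 0 R = {}")
  case True
  then have "x \<notin> S \<or> \<not> norm x \<le> R" for x by auto
  then show ?thesis by (intro that[of 1]) auto
next
  case False
  have "compact (S \<inter> cball 0 R)" using S by (simp add: closed_Int_compact)
  moreover have "continuous_on (S \<inter> cball 0 R) l"
    using l by (auto simp: pos_def_def intro: continuous_on_subset)
  ultimately obtain p where p: "p \<in> S \<inter> cball 0 R" "\<And>x. x \<in> S \<inter> cball 0 R \<Longrightarrow> l p \<le> l x"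
    using continuous_attains_inf False by metis
  then have "l p > 0" using l S(2) unfolding pos_def_def by (metis IntE p(1))
  \<comment> \<open>Half the minimum makes the bound strict, as \<open>dini_upper_decrease\<close>
    demands.\<close>
  then show ?thesis using p(2) by (intro that[of "l p / 2"]) fastforce+
qed

text \<open>Values below 1 confine the argument to a ball, by properness; in that ball
  \<open>U\<close> has a positive lower bound away from the origin. Small values thus force small
  arguments.\<close>

lemma pos_def_proper_tendsto_zero:
  fixes U :: "'a::euclidean_space \<Rightarrow> real"
  assumes U: "pos_def U" "radially_proper U"
    and lim: "Limsup F (\<lambda>t. ereal (U (Y t))) \<le> 0"
  shows "(Y \<longlongrightarrow> 0) F"
proof (rule tendstoI)
  fix e :: real assume e: "e > 0"
  have nonneg: "U x \<ge> 0" for x using U(1) by (cases "x = 0") (auto simp: pos_def_def less_imp_le)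
  have "\<forall>\<^sub>F x in at_infinity. 1 \<le> \<bar>U x\<bar>"
    using U(2) by (auto simp: radially_proper_def filterlim_at_top)
  then obtain R where R: "\<And>x. R \<le> norm x \<Longrightarrow> 1 \<le> U x"
    unfolding eventually_at_infinity using nonneg by auto
  obtain k where k: "k > 0" "\<And>x. x \<in> - ball 0 e \<Longrightarrow> norm x \<le> R \<Longrightarrow> k < U x"
    by (rule pos_def_lower_bound[OF U(1), of "- ball 0 e" R]) (use e in auto)
  have "Limsup F (\<lambda>t. ereal (U (Y t))) < ereal (min k 1)"
    using lim k(1) by (auto elim!: order.strict_trans1 simp flip: zero_ereal_def)
  then have "\<forall>\<^sub>F t in F. ereal (U (Y t)) < ereal (min k 1)" by (rule Limsup_lessD)
  then show "\<forall>\<^sub>F t in F. dist (Y t) 0 < e"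
  proof eventually_elim
    case (elim t)
    then have "U (Y t) < k" "U (Y t) < 1" by auto
    then show ?case using R[of "Y t"] k(2)[of "Y t"] by force
  qed
qed

section \<open>Invariant boxes and the basin of attraction\<close>

text \<open>The inequalities linking \<open>a\<close> and \<open>b\<close> activate the decrease on
  the faces: on \<open>V x = a\<close> one has
  \<open>\<gamma> (W z) \<le> \<gamma> b \<le> V x\<close>, and on \<open>W z = b\<close> one has
  \<open>\<delta> (V x) \<le> \<delta> a \<le> W z\<close>.\<close>

lemma box_subset_basin_of_attraction:
  fixes f :: "'a::euclidean_space \<times> 'b::euclidean_space \<Rightarrow> 'a" and g :: "'a \<times> 'b \<Rightarrow> 'b"
  assumes C1: "C1_on UNIV f" "C1_on UNIV g"
    and V: "locally_lipschitz_on UNIV V" "Kinf_bounded V"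
    and W: "locally_lipschitz_on UNIV W" "Kinf_bounded W"
    and lx: "pos_def lx" and lz: "pos_def lz"
    and \<gamma>: "class_Kinf \<gamma>" and \<delta>: "class_Kinf \<delta>"
    and a: "0 < a" and b: "0 < b" and \<delta>a: "\<delta> a \<le> b" and \<gamma>b: "\<gamma> b \<le> a"
    and decV: "\<And>x z. V x \<le> a \<Longrightarrow> W z \<le> b \<Longrightarrow> \<gamma> (W z) \<le> V x \<Longrightarrow>
                 dini_upper V x (f (x, z)) \<le> ereal (- lx x)"
    and decW: "\<And>x z. V x \<le> a \<Longrightarrow> W z \<le> b \<Longrightarrow> \<delta> (V x) \<le> W z \<Longrightarrow>
                 dini_upper W z (g (x, z)) \<le> ereal (- lz z)"
    and small_gain: "\<And>s. 0 < s \<Longrightarrow> s \<le> a \<Longrightarrow> \<gamma> (\<delta> s) < s"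
    and y: "V x0 \<le> a" "W z0 \<le> b"
  shows "(x0, z0) \<in> basin_of_attraction (interconnection f g)"
proof -

  \<comment> \<open>Solution of the truncated system\<close>
  let ?h = "interconnection f g"
  obtain R1 R2 where R1: "R1 \<ge> 0" "\<And>x. V x \<le> a \<Longrightarrow> norm x \<le> R1"
    and R2: "R2 \<ge> 0" "\<And>z. W z \<le> b \<Longrightarrow> norm z \<le> R2"
    using Kinf_bounded_sublevel V(2) W(2) by metis
  define R where "R = R1 + R2"
  have R: "R \<ge> 0" using R1 R2 by (simp add: R_def)
  have box_ball: "(x, z) \<in> cball 0 R" if "V x \<le> a" "W z \<le> b" for x z
    using R1(2)[OF that(1)] R2(2)[OF that(2)] norm_Pair_le[of x z] by (simp add: R_def)
  obtain Lf Lg where "Lf-lipschitz_on (cball 0 R) f" "Lg-lipschitz_on (cball 0 R) g"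
    using C1_lipschitz_on_cball C1 by metis
  then have "(sqrt (Lf\<^sup>2 + Lg\<^sup>2))-lipschitz_on (cball 0 R) ?h"
    unfolding interconnection_def by (rule lipschitz_on_Pair)
  then obtain Y where Y: "global_solution (\<lambda>y. ?h (closest_point (cball 0 R) y)) (x0, z0) Y"
    using truncated_solution_exists R by metis
  define X Z where "X t = fst (Y t)" and "Z t = snd (Y t)" for t
  have XZ: "Y t = (X t, Z t)" for t by (simp add: X_def Z_def)
  have Y0: "X 0 = x0" "Z 0 = z0" using Y by (auto simp: global_solution_def X_def Z_def)
  \<comment> \<open>Inside the box the projection is the identity, so \<open>Y\<close> follows the
    true field there.\<close>
  have dY: "(Y has_vector_derivative ?h (Y t)) (at t within {0..})"
    if "0 \<le> t" "V (X t) \<le> a" "W (Z t) \<le> b" for t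
    using Y that box_ball[OF that(2,3)]
    by (auto simp: global_solution_def closest_point_self simp flip: XZ)
  have dX: "(X has_vector_derivative f (X t, Z t)) (at t within {0..})"
    and dZ: "(Z has_vector_derivative g (X t, Z t)) (at t within {0..})"
    if "0 \<le> t" "V (X t) \<le> a" "W (Z t) \<le> b" for t
    using has_derivative_fst[OF dY[OF that, unfolded has_vector_derivative_def]]
      has_derivative_snd[OF dY[OF that, unfolded has_vector_derivative_def]]
    unfolding has_vector_derivative_def X_def[abs_def] Z_def[abs_def] interconnection_def
    by simp_all
  have contY: "continuous_on {0..} Y"
    using Y by (intro continuous_on_vector_derivative) (auto simp: global_solution_def)
  have Vcont: "continuous_on UNIV V" and Wcont: "continuous_on UNIV W"
    using V W by (auto intro: locally_lipschitz_on_imp_continuous_on)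
  have vcont: "continuous_on {0..} (\<lambda>t. V (X t))" and wcont: "continuous_on {0..} (\<lambda>t. W (Z t))"
    unfolding X_def Z_def
    by (auto intro!: continuous_on_compose2[OF Vcont] continuous_on_compose2[OF Wcont]
        continuous_intros contY)
  note V0 = Kinf_bounded_nonneg[OF V(2)] and W0 = Kinf_bounded_nonneg[OF W(2)]

  \<comment> \<open>Decrease rates uniform over the box\<close>
  have Vdec: "\<exists>k>0. \<forall>t\<ge>0. s \<le> V (X t) \<and> V (X t) \<le> a \<and> W (Z t) \<le> b \<and> \<gamma> (W (Z t)) \<le> V (X t) \<longrightarrow>
      (\<forall>\<^sub>F \<tau> in at_right 0. V (X (t + \<tau>)) \<le> V (X t) - k * \<tau>)" if s: "0 < s" for s
  proof -
    have "closed {x. s \<le> V x}" using Vcont by (intro closed_Collect_le) auto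
    moreover have "0 \<notin> {x. s \<le> V x}" using s Kinf_bounded_zero[OF V(2)] by simp
    ultimately obtain k where k: "k > 0" "\<And>x. s \<le> V x \<Longrightarrow> norm x \<le> R1 \<Longrightarrow> k < lx x"
      using pos_def_lower_bound[OF lx] by (metis mem_Collect_eq)
    show ?thesis
      by (intro exI[of _ k] conjI allI impI k(1); elim conjE)
        (rule dini_upper_decrease[OF V(1) dX _ decV k(2)]; simp add: R1)
  qed
  have Wdec: "\<exists>k>0. \<forall>t\<ge>0. s \<le> W (Z t) \<and> V (X t) \<le> a \<and> W (Z t) \<le> b \<and> \<delta> (V (X t)) \<le> W (Z t) \<longrightarrow>
      (\<forall>\<^sub>F \<tau> in at_right 0. W (Z (t + \<tau>)) \<le> W (Z t) - k * \<tau>)" if s: "0 < s" for s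
  proof -
    have "closed {z. s \<le> W z}" using Wcont by (intro closed_Collect_le) auto
    moreover have "0 \<notin> {z. s \<le> W z}" using s Kinf_bounded_zero[OF W(2)] by simp
    ultimately obtain k where k: "k > 0" "\<And>z. s \<le> W z \<Longrightarrow> norm z \<le> R2 \<Longrightarrow> k < lz z"
      using pos_def_lower_bound[OF lz] by (metis mem_Collect_eq)
    show ?thesis
      by (intro exI[of _ k] conjI allI impI k(1); elim conjE)
        (rule dini_upper_decrease[OF W(1) dZ _ decW k(2)]; simp add: R2)
  qed

  \<comment> \<open>Forward invariance of the box\<close>
  have right_pos: "\<forall>\<^sub>F \<tau> in at_right 0. (0::real) < \<tau>" by (simp add: eventually_at_right_less)
  have inv: "V (X t) \<le> a \<and> W (Z t) \<le> b" if "0 \<le> t" for t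
  proof (rule forward_induction[OF _ _ _ that])
    have "{t \<in> {0..}. V (X t) \<le> a \<and> W (Z t) \<le> b}
        = {t \<in> {0..}. V (X t) \<le> a} \<inter> {t \<in> {0..}. W (Z t) \<le> b}" by auto
    then show "closed {t \<in> {0..}. V (X t) \<le> a \<and> W (Z t) \<le> b}"
      by (simp only:)
        (intro closed_Int continuous_on_closed_Collect_le continuous_on_const closed_atLeast
          vcont wcont)
    show "V (X 0) \<le> a \<and> W (Z 0) \<le> b" using y Y0 by simp
  next
    fix t assume t: "0 \<le> t" and box: "V (X t) \<le> a \<and> W (Z t) \<le> b"
    have "\<forall>\<^sub>F \<tau> in at_right 0. V (X (t + \<tau>)) \<le> a"
    proof (cases "V (X t) < a")
      case True
      then show ?thesis using eventually_right_less[OF vcont t True] by (auto elim: eventually_mono)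
    next
      case False
      have "\<gamma> (W (Z t)) \<le> V (X t)"
        using class_Kinf_le[OF \<gamma> W0, of "Z t" b] box \<gamma>b False by simp
      then have "\<exists>k>0. \<forall>\<^sub>F \<tau> in at_right 0. V (X (t + \<tau>)) \<le> V (X t) - k * \<tau>"
        using Vdec[OF a] t box False by (auto simp: not_less)
      then obtain k where k: "k > 0" "\<forall>\<^sub>F \<tau> in at_right 0. V (X (t + \<tau>)) \<le> V (X t) - k * \<tau>"
        by blast
      show ?thesis
        using k(2) right_pos
      proof eventually_elim
        case (elim \<tau>)
        then have "0 < k * \<tau>" using k(1) by simp
        then show ?case using elim box by linarith
      qed
    qed
    moreover have "\<forall>\<^sub>F \<tau> in at_right 0. W (Z (t + \<tau>)) \<le> b"
    proof (cases "W (Z t) < b")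
      case True
      then show ?thesis using eventually_right_less[OF wcont t True] by (auto elim: eventually_mono)
    next
      case False
      have "\<delta> (V (X t)) \<le> W (Z t)"
        using class_Kinf_le[OF \<delta> V0, of "X t" a] box \<delta>a False by simp
      then have "\<exists>k>0. \<forall>\<^sub>F \<tau> in at_right 0. W (Z (t + \<tau>)) \<le> W (Z t) - k * \<tau>"
        using Wdec[OF b] t box False by (auto simp: not_less)
      then obtain k where k: "k > 0" "\<forall>\<^sub>F \<tau> in at_right 0. W (Z (t + \<tau>)) \<le> W (Z t) - k * \<tau>"
        by blast
      show ?thesis
        using k(2) right_pos
      proof eventually_elim
        case (elim \<tau>)
        then have "0 < k * \<tau>" using k(1) by simp
        then show ?case using elim box by linarith
      qed
    qed
    ultimately show "\<forall>\<^sub>F \<tau> in at_right 0. V (X (t + \<tau>)) \<le> a \<and> W (Z (t + \<tau>)) \<le> b"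
      by (rule eventually_conj)
  qed

  \<comment> \<open>Asymptotic gains of the two components\<close>
  have gainV: "\<forall>\<^sub>F t in at_top. V (X t) \<le> \<gamma> r"
    if r: "0 < r" "\<forall>\<^sub>F t in at_top. W (Z t) \<le> r" for r
  proof -
    obtain k where k: "k > 0" "\<And>t. t \<ge> 0 \<Longrightarrow> \<gamma> r \<le> V (X t) \<Longrightarrow> \<gamma> (W (Z t)) \<le> V (X t) \<Longrightarrow>
        \<forall>\<^sub>F \<tau> in at_right 0. V (X (t + \<tau>)) \<le> V (X t) - k * \<tau>"
      using Vdec[OF class_Kinf_pos[OF \<gamma> r(1)]] inv by blast
    \<comment> \<open>Once \<open>W\<close> is at most \<open>r\<close>,
      \<open>V \<ge> \<gamma> r\<close> implies \<open>V \<ge> \<gamma> W\<close>, so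
      \<open>V\<close> falls at a fixed rate and reaches the exact level \<open>\<gamma> r\<close>
      in finite time.\<close>
    show ?thesis
    proof (rule eventually_le_of_decrease[OF vcont k(1)])
      show "\<forall>\<^sub>F t in at_top. \<gamma> r \<le> V (X t) \<longrightarrow>
          (\<forall>\<^sub>F \<tau> in at_right 0. V (X (t + \<tau>)) \<le> V (X t) - k * \<tau>)"
        using r(2) eventually_ge_at_top[of 0]
      proof eventually_elim
        case (elim t)
        then show ?case using class_Kinf_le[OF \<gamma> W0, of "Z t" r] k(2)[of t] by linarith
      qed
    qed
  qed
  have gainW: "\<forall>\<^sub>F t in at_top. W (Z t) \<le> \<delta> r"
    if r: "0 < r" "\<forall>\<^sub>F t in at_top. V (X t) \<le> r" for r
  proof -
    obtain k where k: "k > 0" "\<And>t. t \<ge> 0 \<Longrightarrow> \<delta> r \<le> W (Z t) \<Longrightarrow> \<delta> (V (X t)) \<le> W (Z t) \<Longrightarrow>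
        \<forall>\<^sub>F \<tau> in at_right 0. W (Z (t + \<tau>)) \<le> W (Z t) - k * \<tau>"
      using Wdec[OF class_Kinf_pos[OF \<delta> r(1)]] inv by blast
    show ?thesis
    proof (rule eventually_le_of_decrease[OF wcont k(1)])
      show "\<forall>\<^sub>F t in at_top. \<delta> r \<le> W (Z t) \<longrightarrow>
          (\<forall>\<^sub>F \<tau> in at_right 0. W (Z (t + \<tau>)) \<le> W (Z t) - k * \<tau>)"
        using r(2) eventually_ge_at_top[of 0]
      proof eventually_elim
        case (elim t)
        then show ?case using class_Kinf_le[OF \<delta> V0, of "X t" r] k(2)[of t] by linarith
      qed
    qed
  qed

  \<comment> \<open>Infimum of the eventual bounds on V\<close>
  define A where "A = {s. 0 < s \<and> s \<le> a \<and> (\<forall>\<^sub>F t in at_top. V (X t) \<le> s)}"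
  have "\<forall>\<^sub>F t in at_top. V (X t) \<le> a"
    using eventually_ge_at_top[of 0] by eventually_elim (use inv in blast)
  then have aA: "a \<in> A" using a by (simp add: A_def)
  have A_bdd: "bdd_below A" by (auto simp: A_def intro: bdd_belowI[of _ 0])
  \<comment> \<open>\<open>gainW\<close> followed by \<open>gainV\<close> replaces the bound
    \<open>s\<close> by \<open>\<gamma> (\<delta> s)\<close>; the small gain keeps it below
    \<open>a\<close>.\<close>
  have A_step: "\<gamma> (\<delta> s) \<in> A" if "s \<in> A" for s
    using that gainV[of "\<delta> s"] gainW[of s] small_gain[of s] class_Kinf_pos[OF \<delta>, of s]
      class_Kinf_pos[OF \<gamma>, of "\<delta> s"]
    by (auto simp: A_def)
  have InfA: "Inf A = 0"
  proof (rule ccontr)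
    assume "Inf A \<noteq> 0"
    moreover have "0 \<le> Inf A" using aA by (intro cInf_greatest) (auto simp: A_def)
    moreover have "Inf A \<le> a" using aA A_bdd by (rule cInf_lower)
    ultimately have I: "0 < Inf A" "\<gamma> (\<delta> (Inf A)) < Inf A" using small_gain by auto
    \<comment> \<open>A positive infimum is mapped strictly below itself. By continuity so are
      members of \<open>A\<close> just above it, and their images lie in \<open>A\<close>.\<close>
    have "isCont (\<lambda>s. \<gamma> (\<delta> s)) (Inf A)"
      by (rule isCont_o2[OF class_Kinf_isCont[OF \<delta> I(1)]
            class_Kinf_isCont[OF \<gamma> class_Kinf_pos[OF \<delta> I(1)]]])
    then have "\<forall>\<^sub>F s in at_right (Inf A). \<gamma> (\<delta> s) < Inf A"
      using I(2) by (intro order_tendstoD) (auto simp: isCont_def intro: tendsto_within_subset)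
    then obtain e where e: "e > Inf A" "\<And>s. Inf A < s \<Longrightarrow> s < e \<Longrightarrow> \<gamma> (\<delta> s) < Inf A"
      unfolding eventually_at_right_field by auto
    obtain s where s: "s \<in> A" "s < e" using cInf_lessD[OF _ e(1)] aA by auto
    have "Inf A \<le> s" using s(1) A_bdd by (rule cInf_lower)
    then have "\<gamma> (\<delta> s) < Inf A" using e(2)[of s] s(2) I(2) by (cases "s = Inf A") auto
    then show False using cInf_lower[OF A_step[OF s(1)] A_bdd] by simp
  qed
  have Vlim: "((\<lambda>t. V (X t)) \<longlongrightarrow> 0) at_top"
  proof (rule tendstoI)
    fix e :: real assume "e > 0"
    then obtain s where "s \<in> A" "s < e" using cInf_lessD[of A e] InfA aA by auto
    then have "\<forall>\<^sub>F t in at_top. V (X t) \<le> s" "s < e" by (auto simp: A_def)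
    then show "\<forall>\<^sub>F t in at_top. dist (V (X t)) 0 < e"
      by (auto elim!: eventually_mono simp: dist_real_def V0)
  qed
  have Wlim: "((\<lambda>t. W (Z t)) \<longlongrightarrow> 0) at_top"
  proof (rule tendstoI)
    fix e :: real assume e: "e > 0"
    \<comment> \<open>Since \<open>\<delta>\<close> vanishes continuously at 0 from the right, a
      small eventual bound on \<open>V\<close> gives a small one on \<open>W\<close>.\<close>
    have "continuous_on {0..} \<delta>" using \<delta> by (simp add: class_Kinf_def class_K_def)
    then have "(\<delta> \<longlongrightarrow> \<delta> 0) (at 0 within {0..})" by (simp add: continuous_on_def)
    then have "(\<delta> \<longlongrightarrow> 0) (at_right 0)"
      using class_Kinf_zero[OF \<delta>] by (auto intro: tendsto_within_subset)
    then have "\<forall>\<^sub>F s in at_right 0. \<delta> s < e" using e by (rule order_tendstoD)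
    then obtain r where r: "r > 0" "\<And>s. 0 < s \<Longrightarrow> s < r \<Longrightarrow> \<delta> s < e"
      unfolding eventually_at_right_field by auto
    then obtain s where "s \<in> A" "s < r" using cInf_lessD[of A r] InfA aA by auto
    then have "\<forall>\<^sub>F t in at_top. W (Z t) \<le> \<delta> s" "\<delta> s < e"
      using gainW[of s] r by (auto simp: A_def)
    then show "\<forall>\<^sub>F t in at_top. dist (W (Z t)) 0 < e"
      by (auto elim!: eventually_mono simp: dist_real_def W0)
  qed
  have "((\<lambda>t. (X t, Z t)) \<longlongrightarrow> (0, 0)) at_top"
    using Kinf_bounded_tendsto_zero[OF V(2) Vlim] Kinf_bounded_tendsto_zero[OF W(2) Wlim]
    by (rule tendsto_Pair)
  then have "(Y \<longlongrightarrow> 0) at_top" by (simp add: XZ[abs_def] zero_prod_def)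
  \<comment> \<open>By invariance the truncation is inactive at all times.\<close>
  moreover have "global_solution ?h (x0, z0) Y"
    using Y dY inv by (auto simp: global_solution_def)
  ultimately show ?thesis by (auto simp: basin_of_attraction_def)
qed

theorem corollary3p4:
  fixes f :: "(real ^ 'n) \<times> (real ^ 'm) \<Rightarrow> real ^ 'n"
    and g :: "(real ^ 'n) \<times> (real ^ 'm) \<Rightarrow> real ^ 'm"
    and V lx :: "real ^ 'n \<Rightarrow> real"
    and W lz :: "real ^ 'm \<Rightarrow> real"
    and ax az \<gamma> \<delta> :: "real \<Rightarrow> real"
    and M N :: ereal
  assumes "C1_on UNIV f" and "C1_on UNIV g"
    and "ISS (\<lambda>x u. f (x, u))" and "ISS (\<lambda>z v. g (v, z))"
    and "locally_lipschitz_on UNIV V" and "Kinf_bounded V"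
    and "locally_lipschitz_on UNIV W" and "Kinf_bounded W"
    and "pos_def lx" and "radially_proper lx" and "pos_def lz"
    and "class_Kinf ax" and "class_Kinf az"
    and "\<And>x z. norm x \<ge> ax (norm z) \<Longrightarrow> dini_upper V x (f (x, z)) \<le> ereal (- lx x)"
    and "\<And>x z. W z \<ge> az (norm x) \<Longrightarrow> dini_upper W z (g (x, z)) \<le> ereal (- lz z)"
    and "region_gain_condition f g V W lx lz 0 M 0 N \<gamma> \<delta>"
    and "M < \<infinity> \<or> N < \<infinity>"
  shows "(\<exists>U. decay_function (interconnection f g) (M_tilde 0 0 \<gamma>) (M_hat M N \<delta>) U) \<and>
         (\<forall>U. decay_function (interconnection f g) (M_tilde 0 0 \<gamma>) (M_hat M N \<delta>) U \<longrightarrow>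
            {y. ereal (U y) \<le> M_hat M N \<delta>} \<subseteq> basin_of_attraction (interconnection f g)) \<and>
         (C1_on {0..} \<gamma> \<and> C1_on {0..} \<delta> \<longrightarrow>
            {y. ereal (explicit_U V W \<gamma> \<delta> y) \<le> M_hat M N \<delta>}
              \<subseteq> basin_of_attraction (interconnection f g))"
proof -

  \<comment> \<open>The critical levels\<close>
  let ?h = "interconnection f g"
  note V = assms(5,6) and W = assms(7,8)
  note V0 = Kinf_bounded_nonneg[OF V(2)] and W0 = Kinf_bounded_nonneg[OF W(2)]
  have M: "0 < M" and N: "0 < N" and \<gamma>: "class_Kinf \<gamma>" and \<delta>: "class_Kinf \<delta>"
    and dec: "\<And>x z. (x, z) \<in> gain_region V W 0 M 0 N \<Longrightarrow>
      (\<gamma> (W z) \<le> V x \<longrightarrow> dini_upper V x (f (x, z)) \<le> ereal (- lx x)) \<and>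
      (\<delta> (V x) \<le> W z \<longrightarrow> dini_upper W z (g (x, z)) \<le> ereal (- lz z))"
    and small_gain: "\<And>s. 0 < s \<Longrightarrow> ereal s \<le> M \<Longrightarrow> \<gamma> (\<delta> s) < s"
    using assms(16) unfolding region_gain_condition_def by (auto simp: zero_ereal_def)
  have M_tilde: "M_tilde 0 0 \<gamma> = 0"
    by (simp add: M_tilde_def Kinf_inv_zero[OF \<gamma>])
  have "0 < M_hat M N \<delta>"
    using M N class_Kinf_pos[OF \<delta>] by (cases M) (auto simp: M_hat_def Kinf_ext_def)
  moreover have "M_hat M N \<delta> < \<infinity>"
    using assms(17) by (cases M; cases N) (auto simp: M_hat_def Kinf_ext_def min_def)
  ultimately obtain b where b: "M_hat M N \<delta> = ereal b" "0 < b"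
    by (cases "M_hat M N \<delta>") auto
  have bN: "ereal b \<le> N" by (simp flip: b(1) add: M_hat_def)
  have b\<delta>M: "b \<le> \<delta> m" if "M = ereal m" for m
    using b(1) that by (auto simp: M_hat_def Kinf_ext_def min_def split: if_splits)
  have \<gamma>b: "0 < \<gamma> b" using \<gamma> b(2) by (rule class_Kinf_pos)
  \<comment> \<open>For finite \<open>M = m\<close>, \<open>b \<le> \<delta> m\<close> and the small
    gain at \<open>m\<close> give \<open>\<gamma> b \<le> \<gamma> (\<delta> m) < m\<close>.\<close>
  have \<gamma>bM: "ereal (\<gamma> b) \<le> M"
  proof (cases M)
    case (real m)
    then have m: "0 < m" "\<gamma> (\<delta> m) < m" using M small_gain by auto
    then have "\<gamma> b \<le> \<gamma> (\<delta> m)"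
      using b(2) b\<delta>M[OF real] by (intro class_Kinf_le[OF \<gamma>]) auto
    then show ?thesis using m real by simp
  qed (use M in auto)
  \<comment> \<open>Otherwise \<open>\<gamma> b < \<gamma> (\<delta> (\<gamma> b))\<close>, against
    the small gain at \<open>\<gamma> b\<close>.\<close>
  have \<delta>\<gamma>b: "\<delta> (\<gamma> b) \<le> b"
    using small_gain[OF \<gamma>b \<gamma>bM] class_Kinf_less[OF \<gamma>, of b "\<delta> (\<gamma> b)"] b(2) by force

  \<comment> \<open>Boxes inside the basin\<close>
  have box: "(x, z) \<in> basin_of_attraction ?h"
    if a: "\<gamma> b \<le> a" "\<delta> a \<le> b" "ereal a \<le> M" and xz: "V x \<le> a" "W z \<le> b" for x z a
  proof (rule box_subset_basin_of_attraction[where a = a and b = b])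
    show "0 < a" using \<gamma>b a(1) by simp
    \<comment> \<open>As \<open>V\<close> is nonnegative and the lower levels are 0, the gain region
      contains every point with \<open>V x \<le> M\<close> and \<open>W z \<le> N\<close>.\<close>
    have region: "(x, z) \<in> gain_region V W 0 M 0 N" if "V x \<le> a" "W z \<le> b" for x z
      using that a(3) bN V0 by (auto simp: gain_region_def intro: order_trans[of _ "ereal _"])
    show "dini_upper V x (f (x, z)) \<le> ereal (- lx x)"
      if "V x \<le> a" "W z \<le> b" "\<gamma> (W z) \<le> V x" for x z
      using dec[OF region] that by blast
    show "dini_upper W z (g (x, z)) \<le> ereal (- lz z)"
      if "V x \<le> a" "W z \<le> b" "\<delta> (V x) \<le> W z" for x z
      using dec[OF region] that by blast
    show "\<gamma> (\<delta> s) < s" if "0 < s" "s \<le> a" for s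
      using that a(3) by (intro small_gain) (auto intro: order_trans[of _ "ereal a"])
  qed (use assms \<gamma> \<delta> b a xz in auto)
  \<comment> \<open>The smallest admissible side, \<open>a = \<gamma> b\<close>.\<close>
  note box' = box[OF order_refl \<delta>\<gamma>b \<gamma>bM]
  \<comment> \<open>A decay function constrains trajectories only from points with
    \<open>U y > 0\<close>; the origin is covered by the box.\<close>
  have zero: "0 \<in> basin_of_attraction ?h"
    using box'[of 0 0] \<gamma>b b(2) Kinf_bounded_zero[OF V(2)] Kinf_bounded_zero[OF W(2)]
    by (simp add: zero_prod_def)

  \<comment> \<open>Existence of a decay function\<close>
  have "\<exists>U. decay_function ?h 0 (ereal b) U"
  proof -
    let ?S = "{y. V (fst y) < \<gamma> b \<and> W (snd y) < b}"
    have cont: "continuous_on UNIV V" "continuous_on UNIV W"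
      using V W by (auto intro: locally_lipschitz_on_imp_continuous_on)
    have "open ?S"
      by (intro open_Collect_conj open_Collect_less continuous_on_compose2[OF cont(1)]
          continuous_on_compose2[OF cont(2)] continuous_intros) auto
    moreover have "0 \<in> ?S"
      using \<gamma>b b(2) Kinf_bounded_zero[OF V(2)] Kinf_bounded_zero[OF W(2)] by simp
    ultimately obtain r where r: "r > 0" "ball 0 r \<subseteq> ?S"
      using open_contains_ball by blast
    \<comment> \<open>With this slope, \<open>c * norm y \<le> b\<close> means
      \<open>norm y \<le> r / 2\<close>, strictly inside the ball of radius
      \<open>r\<close>.\<close>
    define c where "c = 2 * b / r"
    have c: "c > 0" using r b by (simp add: c_def)
    have "radially_proper (\<lambda>y::(real^'n) \<times> (real^'m). c * norm y)"
      unfolding radially_proper_def using c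
      by (auto simp: abs_mult intro!: filterlim_tendsto_pos_mult_at_top filterlim_norm_at_top)
    moreover have "pos_def (\<lambda>y::(real^'n) \<times> (real^'m). c * norm y)"
      using c by (auto simp: pos_def_def intro!: continuous_intros)
    moreover have lip: "c-lipschitz_on S (\<lambda>y::(real^'n) \<times> (real^'m). c * norm y)" for S
      using c by (intro lipschitz_onI)
        (auto simp: dist_norm abs_mult norm_triangle_ineq3 simp flip: right_diff_distrib)
    have "locally_lipschitz_on (- {0}) (\<lambda>y::(real^'n) \<times> (real^'m). c * norm y)"
      unfolding locally_lipschitz_on_def by (intro ballI exI[of _ 1] exI[of _ c] conjI lip) simp
    moreover have "\<exists>Y. global_solution ?h y Y \<and> Limsup at_top (\<lambda>t. ereal (c * norm (Y t))) \<le> ereal 0"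
      if "ereal (c * norm y) \<le> ereal b" for y
    proof -
      have "norm y < r" using that r b by (simp add: c_def field_simps)
      then have "y \<in> ?S" using r by auto
      then have "y \<in> basin_of_attraction ?h" using box'[of "fst y" "snd y"] by simp
      then obtain Y where Y: "global_solution ?h y Y" "(Y \<longlongrightarrow> 0) at_top"
        by (auto simp: basin_of_attraction_def)
      have "((\<lambda>t. c * norm (Y t)) \<longlongrightarrow> c * norm (0::(real^'n) \<times> (real^'m))) at_top"
        by (intro tendsto_intros Y)
      then have "((\<lambda>t. ereal (c * norm (Y t))) \<longlongrightarrow> ereal 0) at_top" by simp
      then have "Limsup at_top (\<lambda>t. ereal (c * norm (Y t))) = ereal 0"
        by (intro lim_imp_Limsup) auto
      then show ?thesis using Y(1) by auto
    qed
    ultimately have "decay_function ?h 0 (ereal b) (\<lambda>y. c * norm y)"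
      unfolding decay_function_def by simp
    then show ?thesis by (rule exI[of "decay_function ?h 0 (ereal b)"])
  qed

  \<comment> \<open>Sublevel set of an arbitrary decay function\<close>
  moreover have "y \<in> basin_of_attraction ?h"
    if U: "decay_function ?h 0 (ereal b) U" and y: "ereal (U y) \<le> ereal b" for U y
  proof (cases "y = 0")
    case False
    have pd: "pos_def U" "radially_proper U" using U by (auto simp: decay_function_def)
    then have "0 < U y" using False unfolding pos_def_def by blast
    then have "\<exists>Y. global_solution ?h y Y \<and> Limsup at_top (\<lambda>t. ereal (U (Y t))) \<le> 0"
      using U y by (simp add: decay_function_def zero_ereal_def del: split_paired_All)
    then obtain Y where Y: "global_solution ?h y Y"
      and lim: "Limsup at_top (\<lambda>t. ereal (U (Y t))) \<le> 0" by blast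
    have "(Y \<longlongrightarrow> 0) at_top" using pos_def_proper_tendsto_zero[OF pd lim] .
    then show ?thesis using Y by (auto simp: basin_of_attraction_def)
  qed (use zero in simp)

  \<comment> \<open>Sublevel set of the explicit function\<close>
  moreover have "y \<in> basin_of_attraction ?h"
    if y: "ereal (explicit_U V W \<gamma> \<delta> y) \<le> ereal b" for y
  proof -
    obtain x z where xz: "y = (x, z)" by (cases y)
    let ?v = "Kinf_inv \<gamma> (V x)"
    have mean: "\<delta> (V x) + ?v \<le> 2 * b" and Wb: "W z \<le> b"
      using y by (auto simp: xz explicit_U_def)
    note v = class_Kinf_Kinf_inv[OF \<gamma> V0[of x]]
    \<comment> \<open>Otherwise
      \<open>V x = \<gamma> ?v \<le> \<gamma> (\<delta> s) < s \<le> V x\<close>. Allowing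
      \<open>s\<close> below \<open>V x\<close> lets \<open>s = m\<close> be used before
      \<open>V x \<le> M\<close> is known.\<close>
    have less: "\<delta> s < ?v" if s: "0 < s" "ereal s \<le> M" "s \<le> V x" for s
    proof (rule ccontr)
      assume "\<not> \<delta> s < ?v"
      then have "\<gamma> ?v \<le> \<gamma> (\<delta> s)" using v(1) by (intro class_Kinf_le[OF \<gamma>]) auto
      then show False using small_gain[OF s(1,2)] s(3) v(2) by simp
    qed
    have VM: "ereal (V x) \<le> M"
    proof (cases M)
      case (real m)
      have "V x \<le> m"
      proof (rule ccontr)
        \<comment> \<open>Both terms of the mean would exceed
          \<open>\<delta> m \<ge> b\<close>.\<close>
        assume "\<not> V x \<le> m"
        then have "\<delta> m < ?v" "\<delta> m < \<delta> (V x)"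
          using M real by (auto intro!: less class_Kinf_less[OF \<delta>])
        then show False using b\<delta>M[OF real] mean by simp
      qed
      then show ?thesis using real by simp
    qed (use M in auto)
    \<comment> \<open>Here \<open>\<delta> (V x)\<close> is the smaller term of a mean that is at
      most \<open>b\<close>.\<close>
    have \<delta>V: "\<delta> (V x) \<le> b"
    proof (cases "V x = 0")
      case True
      then show ?thesis using class_Kinf_zero[OF \<delta>] b(2) by simp
    next
      case False
      then have "0 < V x" using V0[of x] by simp
      then show ?thesis using less[OF _ VM] mean by simp
    qed
    \<comment> \<open>The maximum enforces \<open>\<gamma> b \<le> a\<close>, while
      \<open>\<delta> a \<le> b\<close> and \<open>a \<le> M\<close> hold for both
      candidates.\<close>
    show ?thesis unfolding xz
      by (rule box[of "max (V x) (\<gamma> b)"]) (use \<delta>V \<delta>\<gamma>b VM \<gamma>bM Wb in \<open>auto simp: max_def\<close>)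
  qed
  ultimately show ?thesis unfolding M_tilde b(1) by auto
qed

end
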